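(* Let $\mathcal{C},\mathcal{D}$ be two neural codes and let $\phi:(\mathcal{P}(\mathcal{D}),\triangle,\cap)\to(\mathcal{P}(\mathcal{C}),\triangle,\cap)$ be a map between these two rings. The following are equivalent: (i) $\phi$ is a ring homomorphism; (ii) $\phi$ satisfies the following three conditions: (H1) $\phi(\{\mathbf{v}^1\})\cap\phi(\{\mathbf{v}^2\})=\emptyset$ for any two distinct $\mathbf{v}^1,\mathbf{v}^2\in\mathcal{D}$; (H2) for every $B\subseteq\mathcal{D}$, $\phi(B)=\bigcup_{\mathbf{v}\in B}\phi(\{\mathbf{v}\})$; (H3) $\phi(\mathcal{D})=\mathcal{C}$; (iii) $\phi=q^{-1}$ for some map $q:\mathcal{C}\to\mathcal{D}$, where $q^{-1}:\mathcal{P}(\mathcal{D})\to\mathcal{P}(\mathcal{C})$ is the preimage map $B\mapsto\{\mathbf{u}\in\mathcal{C}: q(\mathbf{u})\in B\}$.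
   Context: A neural code (code) of length $n\ge 0$ is a subset of $\mathbb{F}_2^n$. For a code $\mathcal{C}$, $(\mathcal{P}(\mathcal{C}),\triangle,\cap)$ denotes the ring whose elements are the subsets of $\mathcal{C}$, with symmetric difference as addition and intersection as multiplication (zero element $\emptyset$, identity element $\mathcal{C}$). Ring homomorphisms preserve the identity element. *)

theory Defs
  imports "HOL-Library.Z2" "HOL-Algebra.Ring" "Jordan_Normal_Form.Matrix"
begin

text \<open>The vector space \<open>\<bbbF>\<^sub>2\<^sup>n\<close> is \<open>carrier_vec n\<close> over the two-element field \<open>bit\<close>; \<open>n = 0\<close> and
  the empty code are allowed.\<close>

definition neural_code :: "nat \<Rightarrow> bit vec set \<Rightarrow> bool" where
  "neural_code n C \<longleftrightarrow> C \<subseteq> carrier_vec n"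

definition powerset_ring :: "'a set \<Rightarrow> 'a set ring" where
  "powerset_ring C =
    \<lparr>carrier = Pow C, mult = (\<inter>), one = C, zero = {}, add = sym_diff\<rparr>"

lemma powerset_ring_cring: "cring (powerset_ring C)"
proof (rule cringI)
  show "abelian_group (powerset_ring C)"
    by (rule abelian_groupI) (auto simp: powerset_ring_def)
  show "comm_monoid (powerset_ring C)"
    by (rule comm_monoidI) (auto simp: powerset_ring_def)
qed (auto simp: powerset_ring_def)

end

theory Submission
  imports Defs
begin

text \<open>A ring homomorphism of power set rings preserves disjointness and disjoint unions. As \<open>D\<close> is
  finite, its value at \<open>B\<close> is therefore the union of its values at the singletons of \<open>B\<close>. The values
  at all the singletons of \<open>D\<close> then partition \<open>C\<close>, and such a partition is the same thing as a map
  \<open>C \<rightarrow> D\<close>, sending \<open>u\<close> to the index of its block.\<close>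

text \<open>Each vector is \<open>vec_of_list\<close> of its own entry list, and there are only
  finitely many lists of length \<open>n\<close> over \<open>{0, 1}\<close>. This makes every code
  finite, so that induction over its subsets is possible.\<close>

lemma finite_carrier_vec_bit: "finite (carrier_vec n :: bit vec set)"
proof -
  have "finite {xs :: bit list. set xs \<subseteq> {0, 1} \<and> length xs = n}"
    by (rule finite_lists_length_eq) simp
  moreover have "carrier_vec n \<subseteq> vec_of_list ` {xs :: bit list. set xs \<subseteq> {0, 1} \<and> length xs = n}"
  proof
    fix v :: "bit vec"
    assume "v \<in> carrier_vec n"
    moreover have "set (list_of_vec v) \<subseteq> {0, 1}"
      by (metis bit_not_zero_iff insertCI subsetI)
    ultimately have "list_of_vec v \<in> {xs. set xs \<subseteq> {0, 1} \<and> length xs = n}"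
      by simp
    then show "v \<in> vec_of_list ` {xs :: bit list. set xs \<subseteq> {0, 1} \<and> length xs = n}"
      by (metis image_eqI vec_list)
  qed
  ultimately show ?thesis
    by (rule finite_surj)
qed

text \<open>Replaces the ring records by plain set equations, the form in which all later arguments
  use a homomorphism.\<close>

lemma powerset_ring_hom_iff:
  "\<phi> \<in> ring_hom (powerset_ring D) (powerset_ring C) \<longleftrightarrow>
    \<phi> \<in> Pow D \<rightarrow> Pow C \<and>
    (\<forall>A \<subseteq> D. \<forall>B \<subseteq> D. \<phi> (A \<inter> B) = \<phi> A \<inter> \<phi> B \<and> \<phi> (sym_diff A B) = sym_diff (\<phi> A) (\<phi> B)) \<and>
    \<phi> D = C"
  unfolding ring_hom_def powerset_ring_def by auto

text \<open>Any set has empty symmetric difference with itself, so additivity at \<open>{}\<close>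
  and \<open>{}\<close> forces the value.\<close>

lemma powerset_ring_hom_empty:
  assumes "\<phi> \<in> ring_hom (powerset_ring D) (powerset_ring C)"
  shows "\<phi> {} = {}"
proof -
  have "\<phi> (sym_diff {} {}) = sym_diff (\<phi> {}) (\<phi> {})"
    using assms unfolding powerset_ring_hom_iff by blast
  then show ?thesis by simp
qed

lemma powerset_ring_hom_disjoint:
  assumes "\<phi> \<in> ring_hom (powerset_ring D) (powerset_ring C)"
    and "A \<subseteq> D" "B \<subseteq> D" "A \<inter> B = {}"
  shows "\<phi> A \<inter> \<phi> B = {}"
proof -
  have "\<phi> A \<inter> \<phi> B = \<phi> (A \<inter> B)"
    using assms unfolding powerset_ring_hom_iff by blast
  then show ?thesis
    using assms powerset_ring_hom_empty by metis
qed

text \<open>Symmetric difference and union agree on disjoint sets. This applies to \<open>A\<close>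
  and \<open>B\<close> and also to their images, which are disjoint by multiplicativity.\<close>

lemma powerset_ring_hom_disjoint_Un:
  assumes "\<phi> \<in> ring_hom (powerset_ring D) (powerset_ring C)"
    and "A \<subseteq> D" "B \<subseteq> D" "A \<inter> B = {}"
  shows "\<phi> (A \<union> B) = \<phi> A \<union> \<phi> B"
proof -
  have "\<phi> (sym_diff A B) = sym_diff (\<phi> A) (\<phi> B)"
    using assms unfolding powerset_ring_hom_iff by blast
  moreover have "sym_diff A B = A \<union> B"
    using assms by blast
  ultimately show ?thesis
    using powerset_ring_hom_disjoint[OF assms] by auto
qed

text \<open>Induction on \<open>B\<close> splits off one singleton at a time; additivity controls
  only finite unions, hence the finiteness assumption.\<close>

lemma powerset_ring_hom_eq_UN:
  assumes hom: "\<phi> \<in> ring_hom (powerset_ring D) (powerset_ring C)"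
    and "finite B" "B \<subseteq> D"
  shows "\<phi> B = (\<Union>v\<in>B. \<phi> {v})"
  using assms(2,3)
proof (induction B rule: finite_induct)
  case empty
  then show ?case
    using powerset_ring_hom_empty[OF hom] by simp
next
  case (insert v B)
  then have "\<phi> ({v} \<union> B) = \<phi> {v} \<union> \<phi> B"
    by (intro powerset_ring_hom_disjoint_Un[OF hom]) auto
  then show ?case
    using insert by simp
qed

lemma partition_imp_preimage:
  assumes disj: "\<And>v w. v \<in> D \<Longrightarrow> w \<in> D \<Longrightarrow> v \<noteq> w \<Longrightarrow> \<phi> {v} \<inter> \<phi> {w} = {}"
    and UN: "\<And>B. B \<subseteq> D \<Longrightarrow> \<phi> B = (\<Union>v\<in>B. \<phi> {v})"
    and top: "\<phi> D = C"
  shows "\<exists>q \<in> C \<rightarrow> D. \<forall>B \<subseteq> D. \<phi> B = {u \<in> C. q u \<in> B}"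
proof -
  have C: "C = (\<Union>v\<in>D. \<phi> {v})"
    using UN[OF order_refl] top by simp
  then have "\<forall>u\<in>C. \<exists>v\<in>D. u \<in> \<phi> {v}"
    by blast
  then obtain q where q: "\<And>u. u \<in> C \<Longrightarrow> q u \<in> D \<and> u \<in> \<phi> {q u}"
    by metis
  \<comment> \<open>The block containing \<open>u\<close> is unique: if \<open>v\<close> differed
    from \<open>q u\<close>, then \<open>u\<close> would lie in two disjoint blocks.\<close>
  have q_eq: "q u = v" if "v \<in> D" "u \<in> \<phi> {v}" for u v
    using that q[of u] disj[of v "q u"] C by blast
  have "\<phi> B = {u \<in> C. q u \<in> B}" if "B \<subseteq> D" for B
    unfolding UN[OF that] using that q q_eq C by blast
  with q show ?thesis
    by blast
qed

text \<open>Taking preimages commutes with all Boolean operations, and the preimage of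
  \<open>D\<close> is all of \<open>C\<close> because \<open>q\<close> maps into
  \<open>D\<close>.\<close>

lemma preimage_ring_hom:
  assumes "q \<in> C \<rightarrow> D" and pre: "\<And>B. B \<subseteq> D \<Longrightarrow> \<phi> B = {u \<in> C. q u \<in> B}"
  shows "\<phi> \<in> ring_hom (powerset_ring D) (powerset_ring C)"
  unfolding powerset_ring_hom_iff
proof (intro conjI allI impI)
  fix A B
  assume "A \<subseteq> D" "B \<subseteq> D"
  \<comment> \<open>The formula \<open>pre\<close> speaks only of subsets of \<open>D\<close>, so
    these inclusions are required before rewriting with it.\<close>
  moreover from this have "A \<inter> B \<subseteq> D" "sym_diff A B \<subseteq> D"
    by auto
  ultimately show "\<phi> (A \<inter> B) = \<phi> A \<inter> \<phi> B" "\<phi> (sym_diff A B) = sym_diff (\<phi> A) (\<phi> B)"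
    by (auto simp: pre)
qed (use assms in auto)

theorem theorem2p3:
  fixes m n :: nat
    and C D :: "bit vec set"
    and \<phi> :: "bit vec set \<Rightarrow> bit vec set"
  assumes "neural_code m C"
    and "neural_code n D"
    and "\<phi> \<in> Pow D \<rightarrow> Pow C"
  shows "(\<phi> \<in> ring_hom (powerset_ring D) (powerset_ring C) \<longleftrightarrow>
            (\<forall>v1\<in>D. \<forall>v2\<in>D. v1 \<noteq> v2 \<longrightarrow> \<phi> {v1} \<inter> \<phi> {v2} = {}) \<and>
            (\<forall>B. B \<subseteq> D \<longrightarrow> \<phi> B = (\<Union>v\<in>B. \<phi> {v})) \<and>
            \<phi> D = C)
       \<and> (\<phi> \<in> ring_hom (powerset_ring D) (powerset_ring C) \<longleftrightarrow>
            (\<exists>q \<in> C \<rightarrow> D. \<forall>B. B \<subseteq> D \<longrightarrow> \<phi> B = {u \<in> C. q u \<in> B}))"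
proof -
  let ?hom = "\<phi> \<in> ring_hom (powerset_ring D) (powerset_ring C)"
  let ?H = "(\<forall>v1\<in>D. \<forall>v2\<in>D. v1 \<noteq> v2 \<longrightarrow> \<phi> {v1} \<inter> \<phi> {v2} = {}) \<and>
    (\<forall>B. B \<subseteq> D \<longrightarrow> \<phi> B = (\<Union>v\<in>B. \<phi> {v})) \<and> \<phi> D = C"
  let ?pre = "\<exists>q \<in> C \<rightarrow> D. \<forall>B. B \<subseteq> D \<longrightarrow> \<phi> B = {u \<in> C. q u \<in> B}"
  have "finite D"
    using assms(2) finite_carrier_vec_bit finite_subset unfolding neural_code_def by blast
  \<comment> \<open>Both equivalences follow from the cycle \<open>?hom\<close> to \<open>?H\<close>
    to \<open>?pre\<close> and back to \<open>?hom\<close>. Only this first implication uses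
    \<open>finite D\<close>.\<close>
  have "?H" if hom: ?hom
  proof (intro conjI ballI allI impI)
    show "\<phi> {v1} \<inter> \<phi> {v2} = {}" if "v1 \<in> D" "v2 \<in> D" "v1 \<noteq> v2" for v1 v2
      using that by (intro powerset_ring_hom_disjoint[OF hom]) auto
    show "\<phi> B = (\<Union>v\<in>B. \<phi> {v})" if "B \<subseteq> D" for B
      using powerset_ring_hom_eq_UN[OF hom finite_subset[OF that \<open>finite D\<close>] that] .
    show "\<phi> D = C"
      using hom unfolding powerset_ring_hom_iff by blast
  qed
  moreover have ?pre if ?H
    using that by (intro partition_imp_preimage) blast+
  moreover have ?hom if ?pre
    using that preimage_ring_hom by blast
  ultimately show ?thesis
    by argo
qed

end
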